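(* Let $\mathcal{H}$ be a complex Hilbert space and let $T\in\mathcal{L}^h$ have closed range with positive orthogonal decomposition $T=T_1-T_2$. Then: (1) If $T_1\neq 0$, then $T=T_1^\dagger-T_2-V$ (with $V=T_1^\dagger-T_2-T$) is a proper splitting of $T$; moreover, this splitting converges if and only if the MP-proper splitting of $T_1$ converges. (2) If $T_2\neq 0$, then $T=T_1-T_2^\dagger-V$ (with $V=T_1-T_2^\dagger-T$) is a proper splitting of $T$; moreover, this splitting converges if and only if the MP-proper splitting of $T_2$ converges.
   Context: $\mathcal{L}(\mathcal{H})$ is the algebra of bounded linear operators on $\mathcal{H}$; $\mathcal{L}^h$ and $\mathcal{L}^+$ are the sets of selfadjoint and positive (semidefinite) operators in it; $\mathcal{R}(\cdot)$, $\mathcal{N}(\cdot)$ denote range and nullspace; $\rho(\cdot)$ is the spectral radius; $A^\dagger$ is the Moore-Penrose inverse of a closed range operator $A$. A proper splitting of an operator $A$ is a decomposition $A=U-V$ with $U,V\in\mathcal{L}(\mathcal{H})$, $\mathcal{R}(U)=\mathcal{R}(A)$, $\mathcal{N}(U)=\mathcal{N}(A)$; it converges if $\rho(U^\dagger V)<1$. Here $U=T_1^\dagger-T_2$ in (1) and $U=T_1-T_2^\dagger$ in (2). The MP-proper splitting of a normal closed range operator $A$ is $A=A^\dagger-V$, i.e. $U=A^\dagger$ and $V=A^\dagger-A$. The positive orthogonal decomposition of $T\in\mathcal{L}^h$ is the unique decomposition $T=T_1-T_2$ with $T_1,T_2\in\mathcal{L}^+$ and $\overline{\mathcal{R}(T_1)}\oplus\overline{\mathcal{R}(T_2)}=\overline{\mathcal{R}(T)}$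 (orthogonal sum); explicitly $T_1=\frac{|T|+T}{2}$, $T_2=\frac{|T|-T}{2}$. If $\mathcal{R}(T)$ is closed then so are $\mathcal{R}(T_1)$ and $\mathcal{R}(T_2)$. *)

theory Defs
  imports "HOL-Analysis.Analysis"
begin

text \<open>
  A complex Hilbert space, as a class on top of the real one: the real inner product is the real
  part of the complex one. Nothing is lost, since every complex Hilbert space carries this real
  structure. Positive definiteness, the norm and its topology come from \<^class>\<open>real_inner\<close>:
  conjugate symmetry makes \<open>cinner x x\<close> real, so it equals \<open>inner x x\<close>.
\<close>

class scaleC =
  fixes scaleC :: "complex \<Rightarrow> 'a \<Rightarrow> 'a"  (infixr \<open>*\<^sub>C\<close> 75)

class complex_hilbert_space = real_inner + banach + scaleC +
  fixes cinner :: "'a \<Rightarrow> 'a \<Rightarrow> complex"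
  assumes scaleC_add_right: "c *\<^sub>C (x + y) = c *\<^sub>C x + c *\<^sub>C y"
    and scaleC_add_left: "(c + d) *\<^sub>C x = c *\<^sub>C x + d *\<^sub>C x"
    and scaleC_scaleC: "c *\<^sub>C (d *\<^sub>C x) = (c * d) *\<^sub>C x"
    and scaleR_eq_scaleC: "r *\<^sub>R x = complex_of_real r *\<^sub>C x"
    and cinner_commute: "cinner x y = cnj (cinner y x)"
    and cinner_add_left: "cinner (x + y) z = cinner x z + cinner y z"
    and cinner_scaleC_left: "cinner (c *\<^sub>C x) y = c * cinner x y"
    and inner_eq_Re_cinner: "inner x y = Re (cinner x y)"

text \<open>
  The type of the elements of \<open>bounded_ops\<close> is that of the bounded \<^emph>\<open>real\<close>-linear operators;
  membership adds complex linearity.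
\<close>

definition bounded_ops :: "('a::complex_hilbert_space \<Rightarrow>\<^sub>L 'a) set"  (\<open>\<L>\<close>)
  where "\<L> = {A :: 'a \<Rightarrow>\<^sub>L 'a. \<forall>c x. A (c *\<^sub>C x) = c *\<^sub>C A x}"

definition selfadjoint_ops :: "('a::complex_hilbert_space \<Rightarrow>\<^sub>L 'a) set"  (\<open>\<L>\<^sup>h\<close>)
  where "\<L>\<^sup>h = {A \<in> \<L>. \<forall>x y. cinner (A x) y = cinner x (A y)}"

definition positive_ops :: "('a::complex_hilbert_space \<Rightarrow>\<^sub>L 'a) set"  (\<open>\<L>\<^sup>+\<close>)
  where "\<L>\<^sup>+ = {A \<in> \<L>. \<forall>x. cinner (A x) x \<in> \<real>\<^sub>\<ge>\<^sub>0}"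

definition nullspace :: "('a::complex_hilbert_space \<Rightarrow>\<^sub>L 'a) \<Rightarrow> 'a set"
  where "nullspace A = {x. A x = 0}"

definition spectrum :: "('a::complex_hilbert_space \<Rightarrow>\<^sub>L 'a) \<Rightarrow> complex set"
  where "spectrum A =
    {l. \<not> (\<exists>B\<in>\<L>. \<forall>x. B (A x - l *\<^sub>C x) = x \<and> A (B x) - l *\<^sub>C B x = x)}"

text \<open>Only meaningful for \<open>A \<in> \<L>\<close> on a nonzero space: on the zero space the spectrum is empty
  and the supremum of the empty set of reals is unspecified.\<close>

definition spectral_radius :: "('a::complex_hilbert_space \<Rightarrow>\<^sub>L 'a) \<Rightarrow> real"  (\<open>\<rho>\<close>)
  where "\<rho> A = (SUP l\<in>spectrum A. cmod l)"

text \<open>The four Penrose equations; they have a (unique) solution in \<open>\<L>\<close> exactly if \<open>A \<in> \<L>\<close> has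
  closed range.\<close>

definition is_MP_inverse :: "('a::complex_hilbert_space \<Rightarrow>\<^sub>L 'a) \<Rightarrow> ('a \<Rightarrow>\<^sub>L 'a) \<Rightarrow> bool"
  where "is_MP_inverse A X \<longleftrightarrow> X \<in> \<L> \<and>
    A o\<^sub>L X o\<^sub>L A = A \<and> X o\<^sub>L A o\<^sub>L X = X \<and> A o\<^sub>L X \<in> \<L>\<^sup>h \<and> X o\<^sub>L A \<in> \<L>\<^sup>h"

definition MP_inverse :: "('a::complex_hilbert_space \<Rightarrow>\<^sub>L 'a) \<Rightarrow> ('a \<Rightarrow>\<^sub>L 'a)"
    (\<open>_\<^sup>\<dagger>\<close> [1000] 999)
  where "A\<^sup>\<dagger> = (THE X. is_MP_inverse A X)"

definition proper_splitting ::
    "('a::complex_hilbert_space \<Rightarrow>\<^sub>L 'a) \<Rightarrow> ('a \<Rightarrow>\<^sub>L 'a) \<Rightarrow> ('a \<Rightarrow>\<^sub>L 'a) \<Rightarrow> bool"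
  where "proper_splitting A U V \<longleftrightarrow> U \<in> \<L> \<and> V \<in> \<L> \<and> A = U - V \<and>
    range U = range A \<and> nullspace U = nullspace A"

definition convergent_proper_splitting ::
    "('a::complex_hilbert_space \<Rightarrow>\<^sub>L 'a) \<Rightarrow> ('a \<Rightarrow>\<^sub>L 'a) \<Rightarrow> ('a \<Rightarrow>\<^sub>L 'a) \<Rightarrow> bool"
  where "convergent_proper_splitting A U V \<longleftrightarrow>
    proper_splitting A U V \<and> \<rho> (U\<^sup>\<dagger> o\<^sub>L V) < 1"

definition MP_proper_splitting_converges :: "('a::complex_hilbert_space \<Rightarrow>\<^sub>L 'a) \<Rightarrow> bool"
  where "MP_proper_splitting_converges A \<longleftrightarrow> convergent_proper_splitting A (A\<^sup>\<dagger>) (A\<^sup>\<dagger> - A)"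

definition positive_orthogonal_decomposition ::
    "('a::complex_hilbert_space \<Rightarrow>\<^sub>L 'a) \<Rightarrow> ('a \<Rightarrow>\<^sub>L 'a) \<Rightarrow> ('a \<Rightarrow>\<^sub>L 'a) \<Rightarrow> bool"
  where "positive_orthogonal_decomposition T T1 T2 \<longleftrightarrow>
    T1 \<in> \<L>\<^sup>+ \<and> T2 \<in> \<L>\<^sup>+ \<and> T = T1 - T2 \<and>
    (\<forall>x\<in>closure (range T1). \<forall>y\<in>closure (range T2). cinner x y = 0) \<and>
    {x + y |x y. x \<in> closure (range T1) \<and> y \<in> closure (range T2)} = closure (range T)"

end

theory Submission
  imports Defs
begin

text \<open>
  Orthogonality of the ranges gives \<open>T1 T2 = 0\<close>, and every mixed product of \<open>T1, T1\<^sup>\<dagger>\<close> with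
  \<open>T2, T2\<^sup>\<dagger>\<close> vanishes as well. Hence \<open>T1\<^sup>\<dagger> - T2\<close> and \<open>T1 - T2\<^sup>\<dagger>\<close> are Moore-Penrose inverses of each
  other, with the same range projection as \<open>T\<close>, and
  \<open>(T1 - T2\<^sup>\<dagger>)(T1\<^sup>\<dagger> - T1) = T1 (T1\<^sup>\<dagger> - T1)\<close>: the iteration operators of the two splittings coincide,
  so no spectral theory enters. The analytic content is the existence of bounded Moore-Penrose
  inverses. It follows from the projection theorem and the Hellinger-Toeplitz theorem, the latter
  replacing the open mapping theorem.
\<close>

section \<open>Hilbert space analysis: projection theorem and Hellinger-Toeplitz\<close>

text \<open>A minimizing sequence for the distance from \<open>x\<close> to \<open>S\<close> is
  Cauchy; at its limit the first variation of the distance vanishes.\<close>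

lemma closed_subspace_orthogonal_projection:
  fixes S :: "'a::{real_inner,banach} set"
  assumes sub: "subspace S" and cl: "closed S"
  obtains p where "p \<in> S" "\<And>z. z \<in> S \<Longrightarrow> inner (x - p) z = 0"
proof -
  define D where "D = (INF s\<in>S. (norm (x - s))\<^sup>2)"
  have ne: "S \<noteq> {}"
    using subspace_0[OF sub] by blast
  have bdd: "bdd_below ((\<lambda>s. (norm (x - s))\<^sup>2) ` S)"
    by (rule bdd_belowI[of _ 0]) auto
  have Dle: "D \<le> (norm (x - s))\<^sup>2" if "s \<in> S" for s
    unfolding D_def using bdd that by (rule cINF_lower)
  have "\<exists>s\<in>S. (norm (x - s))\<^sup>2 < D + 1 / real (Suc n)" for n
    using cINF_less_iff[OF ne bdd, of "D + 1 / real (Suc n)"]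
    by (simp flip: D_def)
  then obtain s where sS: "\<And>n. s n \<in> S"
    and s: "\<And>n. (norm (x - s n))\<^sup>2 < D + 1 / real (Suc n)"
    by metis
  have dist_s: "(norm (s m - s n))\<^sup>2 \<le> 2 / real (Suc m) + 2 / real (Suc n)" for m n
  proof -
    have mid: "(1/2) *\<^sub>R (s m + s n) \<in> S"
      by (intro subspace_scale subspace_add sub sS)
    \<comment> \<open>Parallelogram law for \<open>x - s m\<close> and \<open>x - s n\<close>. The
      midpoint lies in \<open>S\<close>, so the subtracted term is at least \<open>4 * D\<close> and
      \<open>D\<close> cancels.\<close>
    have "(norm (s m - s n))\<^sup>2 =
        2 * (norm (x - s m))\<^sup>2 + 2 * (norm (x - s n))\<^sup>2 - 4 * (norm (x - (1/2) *\<^sub>R (s m + s n)))\<^sup>2"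
      by (simp add: power2_norm_eq_inner inner_diff_left inner_diff_right inner_add_left
          inner_add_right inner_commute algebra_simps)
    with Dle[OF mid] s[of m] s[of n] show ?thesis
      by simp
  qed
  have "Cauchy s"
  proof (rule metric_CauchyI)
    fix e :: real assume e: "0 < e"
    obtain N where N: "4 / e\<^sup>2 < real N"
      using reals_Archimedean2 by blast
    have "dist (s m) (s n) < e" if "m \<ge> N" "n \<ge> N" for m n
    proof -
      have pos: "0 < real N"
        by (rule le_less_trans[OF _ N]) simp
      have small: "2 / real (Suc k) < 2 / real N" if "k \<ge> N" for k
        using that pos by (intro divide_strict_left_mono) auto
      have "(norm (s m - s n))\<^sup>2 < 4 / real N"
        using dist_s[of m n] small[OF that(1)] small[OF that(2)] by linarith
      also have "\<dots> < e\<^sup>2"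
        using N e pos by (simp add: field_simps)
      finally show ?thesis
        using e by (simp add: dist_norm power2_less_imp_less)
    qed
    then show "\<exists>M. \<forall>m\<ge>M. \<forall>n\<ge>M. dist (s m) (s n) < e"
      by blast
  qed
  then obtain p where p: "s \<longlonglongrightarrow> p"
    using Cauchy_convergent convergent_def by blast
  have pS: "p \<in> S"
    using closed_sequentially[OF cl _ p] sS by blast
  have "(\<lambda>n. (norm (x - s n))\<^sup>2) \<longlonglongrightarrow> (norm (x - p))\<^sup>2"
    by (intro tendsto_intros p)
  moreover have "(\<lambda>n. D + 1 / real (Suc n)) \<longlonglongrightarrow> D + 0"
    by (intro tendsto_add tendsto_const LIMSEQ_Suc[OF lim_1_over_n])
  ultimately have pD: "(norm (x - p))\<^sup>2 \<le> D"
    using s by (intro LIMSEQ_le[where X = "\<lambda>n. (norm (x - s n))\<^sup>2" and Y = "\<lambda>n. D + 1 / real (Suc n)"])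
      (auto intro: less_imp_le)
  have "inner (x - p) z = 0" if z: "z \<in> S" for z
  proof (cases "z = 0")
    case False
    define c where "c = inner (x - p) z"
    \<comment> \<open>This \<open>t\<close> minimizes the squared distance from \<open>x\<close> to
      \<open>p + t *\<^sub>R z\<close>, lowering it by \<open>t * c\<close>, a nonnegative quantity;
      minimality of \<open>p\<close> forces \<open>c = 0\<close>.\<close>
    define t where "t = c / inner z z"
    have zz: "0 < inner z z"
      using False by simp
    have "(norm (x - p))\<^sup>2 \<le> (norm (x - (p + t *\<^sub>R z)))\<^sup>2"
      using pD Dle[of "p + t *\<^sub>R z"] subspace_add[OF sub pS subspace_scale[OF sub z, of t]] by linarith
    also have "\<dots> = (norm (x - p))\<^sup>2 - 2 * t * c + t * t * inner z z"
      by (simp add: power2_norm_eq_inner inner_diff_left inner_diff_right inner_add_left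
          inner_add_right inner_commute c_def algebra_simps)
    also have "t * t * inner z z = t * c"
      using zz by (simp add: t_def)
    finally have "t * c \<le> 0"
      by (simp add: mult.commute)
    then have "c * c \<le> 0"
      using zz by (simp add: t_def field_simps)
    then have "c = 0"
      by (metis mult_eq_0_iff antisym zero_le_square)
    then show ?thesis
      by (simp add: c_def)
  qed simp
  with pS that show thesis
    by blast
qed

text \<open>Baire category: the sets \<open>F n\<close> cover the space, so one of them contains a
  ball, and differences of points of the ball bound \<open>G\<close> near 0.\<close>

theorem Hellinger_Toeplitz:
  fixes G :: "'a::{real_inner,banach} \<Rightarrow> 'a"
  assumes lin: "linear G" and sym: "\<And>x y. inner (G x) y = inner x (G y)"
  shows "bounded_linear G"
proof -
  define F where "F n = {x. norm (G x) \<le> real n}" for n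
  \<comment> \<open>Symmetry exhibits \<open>F n\<close> as an intersection of half-spaces, hence closed, without continuity of \<open>G\<close>.\<close>
  have F_eq: "F n = (\<Inter>y\<in>cball 0 1. {x. inner x (G y) \<le> real n})" for n
  proof (intro set_eqI iffI)
    fix x assume x: "x \<in> F n"
    have "inner x (G y) \<le> real n" if "norm y \<le> 1" for y
    proof -
      have "inner x (G y) \<le> norm (G x) * norm y"
        using norm_cauchy_schwarz[of "G x" y] by (simp add: sym)
      also have "\<dots> \<le> norm (G x)"
        using that by (simp add: mult_left_le)
      finally show ?thesis
        using x by (simp add: F_def)
    qed
    then show "x \<in> (\<Inter>y\<in>cball 0 1. {x. inner x (G y) \<le> real n})"
      by simp
  next
    fix x assume x: "x \<in> (\<Inter>y\<in>cball 0 1. {x. inner x (G y) \<le> real n})"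
    \<comment> \<open>The unit vector along \<open>G x\<close> attains the norm of
      \<open>G x\<close>; if \<open>G x = 0\<close> it is 0, still in the unit ball.\<close>
    then have "inner x (G (sgn (G x))) \<le> real n"
      by (simp add: norm_sgn)
    then have "inner (G x) (sgn (G x)) \<le> real n"
      by (simp add: sym)
    also have "inner (G x) (sgn (G x)) = norm (G x)"
      by (cases "G x = 0")
        (simp_all add: sgn_div_norm power2_norm_eq_inner[symmetric] power2_eq_square)
    finally show "x \<in> F n"
      by (simp add: F_def)
  qed
  have closed_F: "closed (F n)" for n
    unfolding F_eq by (intro closed_INT ballI closed_Collect_le continuous_intros)
  have cover: "(\<Union>n. F n) = UNIV"
    by (auto simp: F_def real_arch_simple)
  have "\<exists>n. interior (F n) \<noteq> {}"
  proof (rule ccontr)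
    assume "\<not> ?thesis"
    then have "euclidean interior_of \<Union>(range F) = {}"
      by (intro Baire_category_alt)
        (auto simp: completely_metrizable_space_euclidean closed_F)
    then show False
      by (simp add: cover)
  qed
  then obtain n a e where e: "0 < e" and ball: "cball a e \<subseteq> F n"
    by (metis ex_in_conv mem_interior_cball)
  have bound: "norm (G x) \<le> norm x * (2 * real n / e)" for x
  proof (cases "x = 0")
    case False
    \<comment> \<open>Scaled to norm \<open>e\<close>, so that \<open>a + u\<close> stays in the
      ball.\<close>
    define u where "u = (e / norm x) *\<^sub>R x"
    have "norm (G (a + u)) \<le> real n" "norm (G a) \<le> real n"
      using ball e False by (auto simp: u_def F_def subset_iff dist_norm)
    moreover have "G u = G (a + u) - G a"
      by (simp add: linear_add[OF lin])
    ultimately have "norm (G u) \<le> 2 * real n"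
      by (smt (verit) norm_triangle_ineq4)
    then show ?thesis
      using e False by (simp add: u_def linear_scale[OF lin] field_simps)
  qed (simp add: linear_0[OF lin])
  show ?thesis
    by (rule bounded_linear_intro[OF _ _ bound]) (simp_all add: linear_add[OF lin] linear_scale[OF lin])
qed

section \<open>Complex inner product and operator classes\<close>

lemma cinner_add_right: "cinner x (y + z) = cinner x y + cinner x z"
  by (metis cinner_add_left cinner_commute complex_cnj_add)

lemma cinner_scaleC_right: "cinner x (c *\<^sub>C y) = cnj c * cinner x y"
  by (metis cinner_scaleC_left cinner_commute complex_cnj_mult)

lemma scaleC_minus1: "- x = (-1) *\<^sub>C x" for x :: "'a::complex_hilbert_space"
  using scaleR_eq_scaleC[of "-1" x] by simp

lemma cinner_minus_left: "cinner (- x) y = - cinner x y"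
  by (simp add: scaleC_minus1[of x] cinner_scaleC_left)

lemma cinner_diff_left: "cinner (x - y) z = cinner x z - cinner y z"
  using cinner_add_left[of x "- y" z] by (simp add: cinner_minus_left)

lemma cinner_diff_right: "cinner x (y - z) = cinner x y - cinner x z"
  by (metis cinner_diff_left cinner_commute complex_cnj_diff)

lemma scaleC_diff_right: "c *\<^sub>C (x - y) = c *\<^sub>C x - c *\<^sub>C y"
  for x y :: "'a::complex_hilbert_space"
  by (metis add_diff_cancel diff_add_cancel scaleC_add_right)

lemma cinner_self_eq_0: "cinner x x = 0 \<longleftrightarrow> x = 0"
  by (metis cinner_diff_left diff_self inner_eq_Re_cinner inner_eq_zero_iff zero_complex.sel(1))

lemma cinner_ext_left: "x = y" if "\<And>z. cinner x z = cinner y z"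
  using that cinner_self_eq_0[of "x - y"] by (simp add: cinner_diff_left)

lemma bounded_opsD: "A \<in> \<L> \<Longrightarrow> A (c *\<^sub>C x) = c *\<^sub>C A x"
  by (simp add: bounded_ops_def)

lemma bounded_ops_diff: "A \<in> \<L> \<Longrightarrow> B \<in> \<L> \<Longrightarrow> A - B \<in> \<L>"
  by (simp add: bounded_ops_def blinfun.diff_left scaleC_diff_right)

lemma selfadjoint_ops_bounded: "A \<in> \<L>\<^sup>h \<Longrightarrow> A \<in> \<L>"
  by (simp add: selfadjoint_ops_def)

lemma selfadjoint_opsD: "A \<in> \<L>\<^sup>h \<Longrightarrow> cinner (A x) y = cinner x (A y)"
  by (simp add: selfadjoint_ops_def)

lemma selfadjoint_ops_diff: "A \<in> \<L>\<^sup>h \<Longrightarrow> B \<in> \<L>\<^sup>h \<Longrightarrow> A - B \<in> \<L>\<^sup>h"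
  by (simp add: selfadjoint_ops_def bounded_ops_diff blinfun.diff_left cinner_diff_left cinner_diff_right)

lemma selfadjoint_ops_compose:
  assumes "A \<in> \<L>\<^sup>h" "B \<in> \<L>\<^sup>h" "\<And>x. A (B x) = B (A x)"
  shows "A o\<^sub>L B \<in> \<L>\<^sup>h"
  using assms by (simp add: selfadjoint_ops_def bounded_ops_def)

lemma selfadjoint_compose_commute:
  assumes "A \<in> \<L>\<^sup>h" "B \<in> \<L>\<^sup>h" "A o\<^sub>L B \<in> \<L>\<^sup>h"
  shows "A (B x) = B (A x)"
  by (rule cinner_ext_left)
    (metis assms blinfun_apply_blinfun_compose selfadjoint_opsD)

text \<open>Complex polarization: a quadratic form with real values comes from a selfadjoint
  operator.\<close>

lemma positive_ops_selfadjoint: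
  assumes "A \<in> \<L>\<^sup>+"
  shows "A \<in> \<L>\<^sup>h"
proof -
  have A: "A \<in> \<L>" and real: "Im (cinner (A x) x) = 0" for x
    using assms by (auto simp: positive_ops_def complex_nonneg_Reals_iff)
  have "cinner (A x) y = cinner x (A y)" for x y
  proof -
    have im: "Im (cinner (A x) y + cinner (A y) x) = 0" for x y
      using real[of "x + y"] real[of x] real[of y]
      by (simp add: blinfun.add_right cinner_add_left cinner_add_right)
    have "cinner (A x) y = cnj (cinner (A y) x)"
      \<comment> \<open>The first instance matches the imaginary parts, the second the real
        parts.\<close>
      using im[of x y] im[of x "\<i> *\<^sub>C y"]
      by (simp add: complex_eq_iff bounded_opsD[OF A] cinner_scaleC_left cinner_scaleC_right)
    then show ?thesis
      using cinner_commute[of x "A y"] by simp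
  qed
  then show ?thesis
    using A by (simp add: selfadjoint_ops_def)
qed

section \<open>Uniqueness and calculus of Moore-Penrose inverses\<close>

lemma is_MP_inverse_unique:
  assumes "is_MP_inverse A X" "is_MP_inverse A Y"
  shows "X = Y"
proof -
  have AXA: "A (X (A x)) = A x" and XAX: "X (A (X x)) = X x" for x
    using assms(1) unfolding is_MP_inverse_def
    by (metis blinfun_apply_blinfun_compose)+
  have AYA: "A (Y (A x)) = A x" and YAY: "Y (A (Y x)) = Y x" for x
    using assms(2) unfolding is_MP_inverse_def
    by (metis blinfun_apply_blinfun_compose)+
  have sa: "A o\<^sub>L X \<in> \<L>\<^sup>h" "A o\<^sub>L Y \<in> \<L>\<^sup>h" "X o\<^sub>L A \<in> \<L>\<^sup>h" "Y o\<^sub>L A \<in> \<L>\<^sup>h"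
    using assms by (auto simp: is_MP_inverse_def)
  \<comment> \<open>Each product is again one of the selfadjoint projections, so its factors
    commute; the reversed product equals the other projection.\<close>
  have "(A o\<^sub>L X) o\<^sub>L (A o\<^sub>L Y) = A o\<^sub>L Y" "(X o\<^sub>L A) o\<^sub>L (Y o\<^sub>L A) = X o\<^sub>L A"
    by (auto intro!: blinfun_eqI simp: AXA AYA)
  then have AX: "A (X x) = A (Y x)" and XA: "X (A x) = Y (A x)" for x
    using selfadjoint_compose_commute[OF sa(1) sa(2), of x]
      selfadjoint_compose_commute[OF sa(3) sa(4), of x] sa
    by (simp_all add: AXA AYA)
  show ?thesis
  proof (rule blinfun_eqI)
    fix x
    have "X x = X (A (Y x))"
      by (metis XAX AX)
    then show "X x = Y x"
      by (simp add: XA YAY)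
  qed
qed

lemma MP_inverse_eqI: "is_MP_inverse A X \<Longrightarrow> A\<^sup>\<dagger> = X"
  unfolding MP_inverse_def by (blast intro: is_MP_inverse_unique)

text \<open>The Moore-Penrose inverse of a selfadjoint operator is selfadjoint and commutes with it; in this
  form the relation is symmetric in the two operators.\<close>

definition selfadjoint_MP_pair ::
    "('a::complex_hilbert_space \<Rightarrow>\<^sub>L 'a) \<Rightarrow> ('a \<Rightarrow>\<^sub>L 'a) \<Rightarrow> bool"
  where "selfadjoint_MP_pair A X \<longleftrightarrow> A \<in> \<L>\<^sup>h \<and> X \<in> \<L>\<^sup>h \<and>
    (\<forall>x. A (X x) = X (A x)) \<and> (\<forall>x. A (A (X x)) = A x) \<and> (\<forall>x. X (X (A x)) = X x)"

lemma selfadjoint_MP_pairD: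
  assumes "selfadjoint_MP_pair A X"
  shows "A \<in> \<L>\<^sup>h" "X \<in> \<L>\<^sup>h" "A (X x) = X (A x)" "A (X (A x)) = A x" "X (X (A x)) = X x"
    "A (A (X x)) = A x" "X (A (X x)) = X x"
  using assms unfolding selfadjoint_MP_pair_def by metis+

lemma selfadjoint_MP_pair_commute: "selfadjoint_MP_pair A X \<Longrightarrow> selfadjoint_MP_pair X A"
  unfolding selfadjoint_MP_pair_def by metis

lemma selfadjoint_MP_pair_MP_inverse:
  assumes "selfadjoint_MP_pair A X"
  shows "A\<^sup>\<dagger> = X"
proof (rule MP_inverse_eqI)
  note AX = selfadjoint_MP_pairD[OF assms]
  have "A o\<^sub>L X \<in> \<L>\<^sup>h" "X o\<^sub>L A \<in> \<L>\<^sup>h"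
    by (rule selfadjoint_ops_compose; simp add: AX)+
  then show "is_MP_inverse A X"
    by (auto simp: is_MP_inverse_def AX(2,4,7) selfadjoint_ops_bounded intro!: blinfun_eqI)
qed

text \<open>Taking adjoints gives \<open>B A = 0\<close>. Since \<open>X = X X A = A X X\<close>,
  and likewise for \<open>Y\<close>, every mixed product contains a factor \<open>A B\<close> or
  \<open>B A\<close>.\<close>

lemma selfadjoint_MP_pair_annihilate:
  assumes "selfadjoint_MP_pair A X" "selfadjoint_MP_pair B Y" "\<And>x. A (B x) = 0"
  shows "A (Y x) = 0" "X (B x) = 0" "X (Y x) = 0"
    "B (A x) = 0" "B (X x) = 0" "Y (A x) = 0" "Y (X x) = 0"
proof -
  note AX = selfadjoint_MP_pairD[OF assms(1)] and BY = selfadjoint_MP_pairD[OF assms(2)]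
  have BA: "B (A x) = 0" for x
    by (rule cinner_ext_left)
      (metis assms(3) AX(1) BY(1) selfadjoint_opsD cinner_diff_left diff_self)
  show "A (Y x) = 0" "X (B x) = 0" "X (Y x) = 0"
    "B (A x) = 0" "B (X x) = 0" "Y (A x) = 0" "Y (X x) = 0"
    using assms(3) BA by (metis AX(3-7) BY(3-7) blinfun.zero_right)+
qed

lemma selfadjoint_MP_pair_diff:
  assumes "selfadjoint_MP_pair A X" "selfadjoint_MP_pair B Y" "\<And>x. A (B x) = 0"
  shows "selfadjoint_MP_pair (A - B) (X - Y)"
  using selfadjoint_MP_pairD[OF assms(1)] selfadjoint_MP_pairD[OF assms(2)]
  unfolding selfadjoint_MP_pair_def
  by (simp add: selfadjoint_ops_diff blinfun.diff_left blinfun.diff_right blinfun.add_right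
      assms(3) selfadjoint_MP_pair_annihilate[OF assms])

text \<open>\<open>A X\<close> and \<open>U W\<close> are the orthogonal projections onto the ranges
  of \<open>A\<close> and \<open>U\<close>, and their kernels are the nullspaces of \<open>A\<close>
  and \<open>U\<close>; one equation thus settles both conditions.\<close>

lemma proper_splitting_MP_pair:
  assumes A: "selfadjoint_MP_pair A X" and U: "selfadjoint_MP_pair U W"
    and eq: "\<And>x. A (X x) = U (W x)"
  shows "proper_splitting A U (U - A)"
proof -
  note A = selfadjoint_MP_pairD[OF A] and U = selfadjoint_MP_pairD[OF U]
  have 1: "U x = A (X (U x))" "A x = U (W (A x))" for x
    by (metis eq A(4) U(4))+
  then have "range U = range A"
    by (metis (no_types, lifting) UNIV_I image_eqI image_subsetI subset_antisym)
  moreover have "nullspace U = nullspace A"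
    unfolding nullspace_def
    by (metis eq A(3,6) U(3,6) blinfun.zero_right)
  ultimately show ?thesis
    using A(1) U(1)
    by (simp add: proper_splitting_def selfadjoint_ops_bounded bounded_ops_diff)
qed

section \<open>Existence of Moore-Penrose inverses\<close>

text \<open>For each \<open>x\<close> the equation \<open>T (T y) = T x\<close> has exactly one
  solution in the range of \<open>T\<close>. The solution map is linear and symmetric, hence
  bounded.\<close>

lemma selfadjoint_closed_range_MP_pair:
  fixes T :: "'a::complex_hilbert_space \<Rightarrow>\<^sub>L 'a"
  assumes T: "T \<in> \<L>\<^sup>h" and closed: "closed (range T)"
  obtains G where "selfadjoint_MP_pair T G"
proof -
  have TL: "T \<in> \<L>"
    using T by (rule selfadjoint_ops_bounded)
  note Tsym = selfadjoint_opsD[OF T]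
  have Tinner: "inner (T x) y = inner x (T y)" for x y
    by (simp add: inner_eq_Re_cinner Tsym)
  have null2: "T x = 0" if "T (T x) = 0" for x
    using Tinner[of x "T x"] that by (simp add: inner_commute)
  have null_range: "y = 0" if "y \<in> range T" "T y = 0" for y
    using that null2 by auto
  have sub: "subspace (range T)"
    by (intro linear_subspace_image subspace_UNIV blinfun.bounded_linear_right bounded_linear.linear)
  \<comment> \<open>Project \<open>x\<close> onto the closed range; the residual is orthogonal to
    the range and so is killed by \<open>T\<close>.\<close>
  have proj: "\<exists>z. T x = T (T z)" for x
  proof -
    obtain p where "p \<in> range T" "\<And>z. z \<in> range T \<Longrightarrow> inner (x - p) z = 0"
      using closed_subspace_orthogonal_projection[OF sub closed] by blast
    moreover from this have "inner (T (x - p)) (T (x - p)) = 0"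
      by (simp add: Tinner)
    ultimately show ?thesis
      by (auto simp: blinfun.diff_right)
  qed
  \<comment> \<open>Use \<open>proj\<close> twice: \<open>T x = T (T z)\<close> and
    \<open>T z = T (T w)\<close>; take \<open>y = T w\<close>.\<close>
  have ex: "\<exists>y\<in>range T. T (T y) = T x" for x
    by (metis proj rangeI)
  \<comment> \<open>On the range of \<open>T\<close> the equation \<open>T\<^sup>2 y = T x\<close> says that \<open>T y\<close> is the projection of \<open>x\<close>, so \<open>g\<close> is \<open>T\<^sup>\<dagger>\<close>.\<close>
  then obtain g where gR: "g x \<in> range T" and TTg: "T (T (g x)) = T x" for x
    by metis
  have unique: "y = z" if "y \<in> range T" "z \<in> range T" "T (T y) = T (T z)" for y z
    using null_range[of "y - z"] null2[of "y - z"] that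
    by (simp add: blinfun.diff_right subspace_diff[OF sub])
  have g_eqI: "g x = y" if "y \<in> range T" "T (T y) = T x" for x y
    using unique[OF gR that(1)] that(2) by (simp add: TTg)
  have g_scaleC: "g (c *\<^sub>C x) = c *\<^sub>C g x" for c x
  proof (rule g_eqI)
    show "c *\<^sub>C g x \<in> range T"
      using gR[of x] by (metis bounded_opsD[OF TL] imageE rangeI)
  qed (simp add: bounded_opsD[OF TL] TTg)
  have g_linear: "linear g"
  proof (rule linearI)
    show "g (x + y) = g x + g y" for x y
      by (rule g_eqI) (simp_all add: subspace_add[OF sub] gR blinfun.add_right TTg)
    show "g (r *\<^sub>R x) = r *\<^sub>R g x" for r x
      by (simp add: scaleR_eq_scaleC g_scaleC)
  qed
  have orth: "cinner (T (g x)) (T z) = cinner x (T z)" for x z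
    by (metis Tsym TTg)
  \<comment> \<open>Both \<open>g x\<close> and \<open>g y\<close> lie in the range of
    \<open>T\<close>, so by \<open>orth\<close> the other argument may be replaced by its projection
    \<open>T (g y)\<close> or \<open>T (g x)\<close>.\<close>
  have g_sym: "cinner (g x) y = cinner x (g y)" for x y
  proof -
    have "cinner (g x) y = cinner (g x) (T (g y))"
      using orth[of y] gR[of x] by (metis cinner_commute imageE)
    also have "\<dots> = cinner (T (g x)) (g y)"
      by (simp add: Tsym)
    also have "\<dots> = cinner x (g y)"
      using orth[of x] gR[of y] by auto
    finally show ?thesis .
  qed
  define G where "G = Blinfun g"
  have "bounded_linear g"
    by (rule Hellinger_Toeplitz[OF g_linear]) (simp add: inner_eq_Re_cinner g_sym)
  then have G: "blinfun_apply G = g"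
    by (simp add: G_def bounded_linear_Blinfun_apply)
  have gT: "g (T x) = T (g x)" for x
    by (rule g_eqI) (simp_all add: TTg)
  have "selfadjoint_MP_pair T G"
    unfolding selfadjoint_MP_pair_def G
  proof (intro conjI allI)
    show "G \<in> \<L>\<^sup>h"
      by (simp add: selfadjoint_ops_def bounded_ops_def G g_scaleC g_sym)
    show "g (g (T x)) = g x" for x
      by (rule g_eqI) (simp_all add: gR gT TTg)
  qed (simp_all add: T TTg gT)
  then show thesis
    by (rule that)
qed

text \<open>A summand \<open>A\<close> commutes with \<open>T\<close> and satisfies \<open>A\<^sup>2 = \<plusminus> T A\<close>, so that with \<open>G = T\<^sup>\<dagger>\<close> the operator
  \<open>G A G\<close> is the Moore-Penrose inverse of \<open>A\<close>.\<close>

lemma selfadjoint_MP_pair_summand: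
  assumes T: "selfadjoint_MP_pair T G" and A: "A \<in> \<L>\<^sup>h" and AT: "\<And>x. A (T x) = T (A x)"
    and sq: "\<And>x. A (A (A x)) = T (T (A x))" and range: "range A \<subseteq> range T"
  shows "selfadjoint_MP_pair A (G o\<^sub>L A o\<^sub>L G)"
proof -
  note TG = selfadjoint_MP_pairD[OF T]
  have TGA: "T (G (A x)) = A x" for x
  proof -
    have "A x \<in> range T"
      using range by blast
    then show ?thesis
      by (auto simp: TG(4))
  qed
  \<comment> \<open>The adjoint of \<open>TGA\<close>.\<close>
  have AGT: "A (G (T x)) = A x" for x
    by (rule cinner_ext_left)
      (simp add: selfadjoint_opsD[OF A] selfadjoint_opsD[OF TG(1)] selfadjoint_opsD[OF TG(2)] TGA)
  have AG: "A (G x) = G (A x)" for x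
  proof -
    have "A (G x) = G (T (A (G x)))"
      using TGA TG(3) by metis
    also have "\<dots> = G (A (T (G x)))"
      by (simp add: AT)
    also have "\<dots> = G (A x)"
      by (simp add: TG(3) AGT)
    finally show ?thesis .
  qed
  have GT: "G (T x) = T (G x)" for x
    by (simp add: TG(3))
  have G: "G \<in> \<L>" "A \<in> \<L>"
    using TG(2) A by (simp_all add: selfadjoint_ops_bounded)
  show ?thesis
    unfolding selfadjoint_MP_pair_def
    using A TG(2) G
    by (simp add: AG AT GT TGA sq selfadjoint_ops_def bounded_ops_def)
qed

section \<open>The positive orthogonal decomposition and its splittings\<close>

lemma positive_orthogonal_decomposition_MP_pairs:
  assumes T: "T \<in> \<L>\<^sup>h" "closed (range T)" and dec: "positive_orthogonal_decomposition T A B"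
  obtains X Y where "selfadjoint_MP_pair A X" "selfadjoint_MP_pair B Y" "\<And>x. A (B x) = 0"
proof -
  have A: "A \<in> \<L>\<^sup>h" and B: "B \<in> \<L>\<^sup>h" and T_eq: "T = A - B"
    using dec by (auto simp: positive_orthogonal_decomposition_def positive_ops_selfadjoint)
  have orth: "cinner (A x) (B y) = 0" for x y
    using dec closure_subset[of "range A"] closure_subset[of "range B"]
    unfolding positive_orthogonal_decomposition_def by blast
  have "{x + y |x y. x \<in> closure (range A) \<and> y \<in> closure (range B)} = range T"
    using dec closure_closed[OF T(2)] by (simp only: positive_orthogonal_decomposition_def)
  then have sum: "x + y \<in> range T" if "x \<in> closure (range A)" "y \<in> closure (range B)" for x y
    using that by blast
  have zero: "0 \<in> closure (range A)" "0 \<in> closure (range B)"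
    using closure_subset by (metis blinfun.zero_right rangeI subsetD)+
  \<comment> \<open>Take 0 as the other summand.\<close>
  have ranges: "range A \<subseteq> range T" "range B \<subseteq> range T"
    using sum[OF subsetD[OF closure_subset] zero(2)] sum[OF zero(1) subsetD[OF closure_subset]]
    by auto
  \<comment> \<open>Moving the outer \<open>B\<close> across turns
    \<open>cinner (B (A x)) (B (A x))\<close> into a product of elements of the two orthogonal
    ranges.\<close>
  have BA: "B (A x) = 0" for x
    by (metis B orth selfadjoint_opsD cinner_self_eq_0)
  have AB: "A (B x) = 0" for x
    by (metis A orth selfadjoint_opsD cinner_self_eq_0 cinner_commute complex_cnj_zero)
  obtain G where G: "selfadjoint_MP_pair T G"
    using selfadjoint_closed_range_MP_pair[OF T] by blast
  note simps = T_eq blinfun.diff_left blinfun.diff_right blinfun.minus_right AB BA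
  show thesis
  proof (rule that)
    show "selfadjoint_MP_pair A (G o\<^sub>L A o\<^sub>L G)"
      by (rule selfadjoint_MP_pair_summand[OF G A _ _ ranges(1)]) (simp_all add: simps)
    show "selfadjoint_MP_pair B (G o\<^sub>L B o\<^sub>L G)"
      by (rule selfadjoint_MP_pair_summand[OF G B _ _ ranges(2)]) (simp_all add: simps)
  qed (rule AB)
qed

theorem theorem4p15:
  fixes T T1 T2 :: "'a::complex_hilbert_space \<Rightarrow>\<^sub>L 'a"
  assumes "T \<in> \<L>\<^sup>h"
    and "closed (range T)"
    and "positive_orthogonal_decomposition T T1 T2"
  shows "(T1 \<noteq> 0 \<longrightarrow>
            proper_splitting T (T1\<^sup>\<dagger> - T2) (T1\<^sup>\<dagger> - T2 - T) \<and>
            (convergent_proper_splitting T (T1\<^sup>\<dagger> - T2) (T1\<^sup>\<dagger> - T2 - T) \<longleftrightarrow>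
              MP_proper_splitting_converges T1)) \<and>
         (T2 \<noteq> 0 \<longrightarrow>
            proper_splitting T (T1 - T2\<^sup>\<dagger>) (T1 - T2\<^sup>\<dagger> - T) \<and>
            (convergent_proper_splitting T (T1 - T2\<^sup>\<dagger>) (T1 - T2\<^sup>\<dagger> - T) \<longleftrightarrow>
              MP_proper_splitting_converges T2))"
proof -
  obtain X Y where X: "selfadjoint_MP_pair T1 X" and Y: "selfadjoint_MP_pair T2 Y"
    and T12: "\<And>x. T1 (T2 x) = 0"
    using positive_orthogonal_decomposition_MP_pairs[OF assms] by blast
  note X' = selfadjoint_MP_pair_commute[OF X] and Y' = selfadjoint_MP_pair_commute[OF Y]
  note annihilate = T12 selfadjoint_MP_pair_annihilate[OF X Y T12]
  have T_eq: "T = T1 - T2"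
    using assms(3) by (simp add: positive_orthogonal_decomposition_def)
  have T: "selfadjoint_MP_pair T (X - Y)"
    unfolding T_eq using X Y T12 by (rule selfadjoint_MP_pair_diff)
  \<comment> \<open>The difference rule for \<open>T\<close>, with the roles of \<open>T1\<close>
    and \<open>X\<close> exchanged.\<close>
  have U1: "selfadjoint_MP_pair (X - T2) (T1 - Y)"
    using X' Y annihilate(3) by (rule selfadjoint_MP_pair_diff)
  have U2: "selfadjoint_MP_pair (T1 - Y) (X - T2)"
    using U1 by (rule selfadjoint_MP_pair_commute)
  note dagger = selfadjoint_MP_pair_MP_inverse[OF X] selfadjoint_MP_pair_MP_inverse[OF Y]
    selfadjoint_MP_pair_MP_inverse[OF X'] selfadjoint_MP_pair_MP_inverse[OF Y']
    selfadjoint_MP_pair_MP_inverse[OF U1] selfadjoint_MP_pair_MP_inverse[OF U2]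
  note XD = selfadjoint_MP_pairD(3)[OF X] and YD = selfadjoint_MP_pairD(3)[OF Y]
  \<comment> \<open>All three operators have range projection \<open>T1 X + T2 Y\<close>.\<close>
  have "proper_splitting T (X - T2) (X - T2 - T)" "proper_splitting T (T1 - Y) (T1 - Y - T)"
    by (rule proper_splitting_MP_pair[OF T U1] proper_splitting_MP_pair[OF T U2],
        simp add: T_eq blinfun.diff_left blinfun.diff_right annihilate XD YD)+
  \<comment> \<open>Properness holds on both sides of each equivalence, so only the spectral radii
    remain to be compared.\<close>
  moreover have "proper_splitting T1 X (X - T1)" "proper_splitting T2 Y (Y - T2)"
    by (rule proper_splitting_MP_pair[OF X X'] proper_splitting_MP_pair[OF Y Y'], simp add: XD YD)+
  \<comment> \<open>In the second identity \<open>T1 - Y - T = T2 - Y\<close>, and the two sign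
    changes cancel.\<close>
  moreover have "(T1 - Y) o\<^sub>L (X - T2 - T) = T1 o\<^sub>L (X - T1)"
    "(X - T2) o\<^sub>L (T1 - Y - T) = T2 o\<^sub>L (Y - T2)"
    by (auto intro!: blinfun_eqI simp: T_eq blinfun.diff_left blinfun.diff_right annihilate)
  ultimately show ?thesis
    by (simp add: convergent_proper_splitting_def MP_proper_splitting_converges_def dagger)
qed

end
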